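(* Let $M$ be a generator of an irreducible Markov chain on a finite state space $\mathcal Z$ and $\zeta\in\mathcal P_+(\mathcal Z)$. Let $\zeta_*=\min_z\zeta(z)$ and let $M_*=\min\{M(z,z'):z,z'\in\mathcal Z,\ M(z,z')>0\}$ be the smallest positive rate in $M$. (1) We have the lower bound $$\alpha_{\mathrm{gPI}}(\zeta)\ge\frac{\zeta_*M_*}{|\mathcal Z|}.$$ (2) With $\lambda_\zeta$ the spectral gap of $-M^\zeta$ and $\alpha_{\mathrm{sLSI}}(M^\zeta)$ the standard log-Sobolev constant of the $\zeta$-symmetrised generator $M^\zeta$, we have $$\alpha_{\mathrm{gLSI}}(\zeta)\ \ge\ 2\alpha_{\mathrm{sLSI}}(M^\zeta)\ \ge\ \frac{\lambda_\zeta}{1+\frac12\log\frac1{\zeta_*}}\ =\ \frac{\alpha_{\mathrm{gPI}}(\zeta)}{1+\frac12\log\frac1{\zeta_*}}\ \ge\ \frac{\zeta_*M_*|\mathcal Z|^{-1}}{1+\frac12\log\frac1{\zeta_*}}.$$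
   Context: $\mathcal Z$ is a finite set with $|\mathcal Z|\ge2$. A generator is a matrix $M\in\mathbb R^{|\mathcal Z|\times|\mathcal Z|}$ with off-diagonal entries $\ge0$ and rows summing to $0$; reversibility is not assumed. $\mathcal P_+(\mathcal Z)$ is the set of strictly positive probability measures on $\mathcal Z$. $\mathbf 1$ is the constant function $1$ and $\langle\mathbf 1\rangle$ its span. For $\zeta\in\mathcal P_+(\mathcal Z)$: $\mathbb E_\zeta[f]=\sum_z f(z)\zeta(z)$; $\operatorname{var}_\zeta(f)=\mathbb E_\zeta[f^2]-(\mathbb E_\zeta[f])^2$; $\mathcal D_\zeta(\mathcal Z)=\{\varphi\in\mathbb R^{|\mathcal Z|}:\varphi(z)>0\ \forall z,\ \mathbb E_\zeta[\varphi]=1\}$; $\mathscr H_\zeta(\varphi)=\sum_z\varphi(z)\log\varphi(z)\,\zeta(z)$; for $f\in\mathbb R^{|\mathcal Z|}_{>0}$ (strictly positive vectors), $\operatorname{Ent}_\zeta(f)=\sum_z f(z)\log f(z)\,\zeta(z)-\mathbb E_\zeta[f]\log\mathbb E_\zeta[f]$. For a generator $K$ on $\mathcal Z$: $$\mathscr E_\zeta(f,K)=\tfrac12\sum_{z,z'}K(z,z')\zeta(z)(f(z)-f(z'))^2,\qquad \mathscr R_\zeta(\varphi,K)=\sum_{z,z'}K(z,z')\zeta(z)\varphi(z)\Bigl[\tfrac{\varphi(z')}{\varphi(z)}-1-\log\tfrac{\varphi(z')}{\varphi(z)}\Bigr].$$ Generalised constants: $$\alpha_{\mathrm{gPI}}(\zeta)=\inf_{f\in\mathbb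 R^{|\mathcal Z|},\,f\notin\langle\mathbf 1\rangle}\frac{\mathscr E_\zeta(f,M)}{\operatorname{var}_\zeta(f)},\qquad \alpha_{\mathrm{gLSI}}(\zeta)=\inf_{\varphi\in\mathcal D_\zeta(\mathcal Z),\,\varphi\ne\mathbf 1}\frac{\mathscr R_\zeta(\varphi,M)}{\mathscr H_\zeta(\varphi)}.$$ The $\zeta$-symmetrised generator $M^\zeta$ is given by $M^\zeta(z,z')=\frac12\bigl(M(z,z')+\frac{\zeta(z')}{\zeta(z)}M(z',z)\bigr)$ for $z'\ne z$ and $M^\zeta(z,z)=-\sum_{z'\ne z}M^\zeta(z,z')$. It is self-adjoint with respect to the inner product $(f,g)_\zeta=\sum_z f(z)g(z)\zeta(z)$ and has steady state $\zeta$; its spectral gap $\lambda_\zeta$ is the smallest nonzero eigenvalue of $-M^\zeta$. The standard log-Sobolev constant of $M^\zeta$ is $$\alpha_{\mathrm{sLSI}}(M^\zeta)=\inf_{f\in\mathbb R^{|\mathcal Z|}_{>0},\,f\notin\langle\mathbf 1\rangle}\frac{\mathscr E_\zeta(f,M^\zeta)}{\operatorname{Ent}_\zeta(f^2)}.$$ *)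

theory Defs
  imports "HOL-Analysis.Analysis"
begin

text \<open>
  The finite state space is a type \<open>'z\<close> of class \<open>finite\<close>; functions and measures on it are
  vectors \<open>real ^ 'z\<close>, and \<open>K $ z $ z'\<close> is the rate of the jump from \<open>z\<close> to \<open>z'\<close>.
  The constant function \<open>\<one>\<close> is the vector \<open>1 :: real ^ 'z\<close>, all of whose entries are \<open>1\<close>.
\<close>

definition generator :: "real ^ 'z ^ 'z::finite \<Rightarrow> bool" where
  "generator K \<longleftrightarrow>
     (\<forall>z z'. z \<noteq> z' \<longrightarrow> K $ z $ z' \<ge> 0) \<and> (\<forall>z. (\<Sum>z'\<in>UNIV. K $ z $ z') = 0)"

text \<open>For a generator the diagonal is nonpositive, so only genuine jumps count as steps below.\<close>

definition irreducible_chain :: "real ^ 'z ^ 'z::finite \<Rightarrow> bool" where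
  "irreducible_chain K \<longleftrightarrow> (\<forall>z z'. (z, z') \<in> {(x, y). K $ x $ y > 0}\<^sup>*)"

definition min_rate :: "real ^ 'z ^ 'z::finite \<Rightarrow> real" where
  "min_rate K = Min {K $ z $ z' | z z'. K $ z $ z' > 0}"

definition pos_prob :: "(real ^ 'z::finite) set" where
  "pos_prob = {\<zeta>. (\<forall>z. \<zeta> $ z > 0) \<and> (\<Sum>z\<in>UNIV. \<zeta> $ z) = 1}"

definition min_weight :: "real ^ 'z::finite \<Rightarrow> real" where
  "min_weight \<zeta> = Min {\<zeta> $ z | z. z \<in> UNIV}"

definition mean :: "real ^ 'z::finite \<Rightarrow> real ^ 'z \<Rightarrow> real" where
  "mean \<zeta> f = (\<Sum>z\<in>UNIV. f $ z * \<zeta> $ z)"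

definition var :: "real ^ 'z::finite \<Rightarrow> real ^ 'z \<Rightarrow> real" where
  "var \<zeta> f = mean \<zeta> (\<chi> z. (f $ z)\<^sup>2) - (mean \<zeta> f)\<^sup>2"

definition densities :: "real ^ 'z::finite \<Rightarrow> (real ^ 'z) set" where
  "densities \<zeta> = {\<phi>. (\<forall>z. \<phi> $ z > 0) \<and> mean \<zeta> \<phi> = 1}"

definition rel_entropy :: "real ^ 'z::finite \<Rightarrow> real ^ 'z \<Rightarrow> real" where
  "rel_entropy \<zeta> \<phi> = (\<Sum>z\<in>UNIV. \<phi> $ z * ln (\<phi> $ z) * \<zeta> $ z)"

definition Ent :: "real ^ 'z::finite \<Rightarrow> real ^ 'z \<Rightarrow> real" where
  "Ent \<zeta> f = (\<Sum>z\<in>UNIV. f $ z * ln (f $ z) * \<zeta> $ z) - mean \<zeta> f * ln (mean \<zeta> f)"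

definition dirichlet_form :: "real ^ 'z::finite \<Rightarrow> real ^ 'z \<Rightarrow> real ^ 'z ^ 'z \<Rightarrow> real" where
  "dirichlet_form \<zeta> f K =
     1/2 * (\<Sum>z\<in>UNIV. \<Sum>z'\<in>UNIV. K $ z $ z' * \<zeta> $ z * (f $ z - f $ z')\<^sup>2)"

definition fisher_info :: "real ^ 'z::finite \<Rightarrow> real ^ 'z \<Rightarrow> real ^ 'z ^ 'z \<Rightarrow> real" where
  "fisher_info \<zeta> \<phi> K =
     (\<Sum>z\<in>UNIV. \<Sum>z'\<in>UNIV. K $ z $ z' * \<zeta> $ z * \<phi> $ z *
        (\<phi> $ z' / \<phi> $ z - 1 - ln (\<phi> $ z' / \<phi> $ z)))"

text \<open>
  For a generator, a strictly positive \<open>\<zeta>\<close> and at least two states, the sets of quotients in the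
  three infima below are nonempty and bounded below by \<open>0\<close>, so the infima over \<open>real\<close> are genuine.
\<close>

definition alpha_gPI :: "real ^ 'z ^ 'z::finite \<Rightarrow> real ^ 'z \<Rightarrow> real" where
  "alpha_gPI M \<zeta> = (INF f \<in> {f. f \<notin> span {1}}. dirichlet_form \<zeta> f M / var \<zeta> f)"

definition alpha_gLSI :: "real ^ 'z ^ 'z::finite \<Rightarrow> real ^ 'z \<Rightarrow> real" where
  "alpha_gLSI M \<zeta> =
     (INF \<phi> \<in> {\<phi>. \<phi> \<in> densities \<zeta> \<and> \<phi> \<noteq> 1}. fisher_info \<zeta> \<phi> M / rel_entropy \<zeta> \<phi>)"

definition alpha_sLSI :: "real ^ 'z ^ 'z::finite \<Rightarrow> real ^ 'z \<Rightarrow> real" where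
  "alpha_sLSI K \<zeta> =
     (INF f \<in> {f. (\<forall>z. f $ z > 0) \<and> f \<notin> span {1}}.
        dirichlet_form \<zeta> f K / Ent \<zeta> (\<chi> z. (f $ z)\<^sup>2))"

definition sym_rate :: "real ^ 'z ^ 'z::finite \<Rightarrow> real ^ 'z \<Rightarrow> 'z \<Rightarrow> 'z \<Rightarrow> real" where
  "sym_rate M \<zeta> z z' = 1/2 * (M $ z $ z' + \<zeta> $ z' / \<zeta> $ z * M $ z' $ z)"

definition sym_generator :: "real ^ 'z ^ 'z::finite \<Rightarrow> real ^ 'z \<Rightarrow> real ^ 'z ^ 'z" where
  "sym_generator M \<zeta> =
     (\<chi> z z'. if z' \<noteq> z then sym_rate M \<zeta> z z' else - (\<Sum>w\<in>UNIV - {z}. sym_rate M \<zeta> z w))"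

definition eigenvalue_of :: "real ^ 'z ^ 'z::finite \<Rightarrow> real \<Rightarrow> bool" where
  "eigenvalue_of A l \<longleftrightarrow> (\<exists>f. f \<noteq> 0 \<and> A *v f = l *\<^sub>R f)"

text \<open>
  Only applied to generators that are self-adjoint with respect to a positive weight, whose
  eigenvalues are all real; hence restricting to real eigenvalues loses nothing.
\<close>

definition spectral_gap :: "real ^ 'z ^ 'z::finite \<Rightarrow> real" where
  "spectral_gap K = Min {l. eigenvalue_of (- K) l \<and> l \<noteq> 0}"

end

theory Submission
  imports Defs
begin

text \<open>
  The form \<open>dirichlet_form \<zeta> f M\<close> only sees the \<open>\<zeta>\<close>-symmetrised rates, so it equals
  \<open>(f, - M\<^sup>\<zeta> f)\<^sub>\<zeta>\<close>; a minimiser of its quotient by the variance is an eigenvector for the spectral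
  gap. Part (1) telescopes \<open>f z - f z'\<close> along a shortest path, which uses every edge at most once.
  The comparison of the log-Sobolev constants is the pointwise inequality
  \<open>r - 1 - ln r \<ge> (sqrt r - 1)\<^sup>2\<close> with \<open>r = \<phi> z' / \<phi> z\<close>.

  The remaining inequality is \<open>Ent (f\<^sup>2) \<le> (2 + ln (1 / \<zeta>\<^sub>*)) var f\<close>, a weak form of Rothaus' lemma:
  writing \<open>f = m + g\<close> with \<open>m\<close> the mean of \<open>f\<close>, the function \<open>F t = Ent ((m + t g)\<^sup>2)\<close> satisfies
  \<open>F 0 = F' 0 = 0\<close> and \<open>F'' \<le> 2 (2 + ln (1 / \<zeta>\<^sub>*)) var f\<close> on \<open>[0, 1]\<close>, because
  \<open>(m + t g)\<^sup>2\<close> is at most \<open>1 / \<zeta>\<^sub>*\<close> times its mean.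
\<close>

section \<open>Energy of a function along a path\<close>

text \<open>A shortest path repeats no vertex, so it has fewer than \<open>CARD('a)\<close> steps
  and its edges are distinct. Cauchy-Schwarz on the telescoping sum costs a factor equal to the
  length, and the edges of the path form only part of the sum over \<open>R\<close>.\<close>

lemma square_diff_le_path_energy:
  fixes f :: "'a::finite \<Rightarrow> real"
  assumes "(a, b) \<in> R\<^sup>*"
  shows "(f a - f b)\<^sup>2 \<le> real CARD('a) * (\<Sum>(x, y)\<in>R. (f x - f y)\<^sup>2)"
proof -
  define n where "n = (LEAST n. (a, b) \<in> R ^^ n)"
  have "\<exists>n. (a, b) \<in> R ^^ n"
    using assms rtrancl_imp_relpow by blast
  then have n: "(a, b) \<in> R ^^ n"
    unfolding n_def by (rule LeastI_ex)
  have n_min: "n \<le> k" if "(a, b) \<in> R ^^ k" for k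
    unfolding n_def using that by (rule Least_le)
  obtain p where p: "p 0 = a" "p n = b" "\<And>i. i < n \<Longrightarrow> (p i, p (Suc i)) \<in> R"
    using n by (auto simp: relpow_fun_conv)
  have sub: "(p i, p j) \<in> R ^^ (j - i)" if "i \<le> j" "j \<le> n" for i j
    unfolding relpow_fun_conv using that p
    by (intro exI[of _ "\<lambda>k. p (i + k)"]) auto
  \<comment> \<open>Between two visits to the same vertex the path could be cut, which would shorten
    it.\<close>
  have "p i \<noteq> p j" if "i < j" "j \<le> n" for i j
  proof
    assume "p i = p j"
    then have "(a, b) \<in> R ^^ i O R ^^ (n - j)"
      using sub[of 0 i] sub[of j n] p that by (auto intro!: relcompI[of _ "p i"])
    then have "(a, b) \<in> R ^^ (i + (n - j))"
      by (simp add: relpow_add)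
    then show False
      using n_min that by fastforce
  qed
  then have inj: "inj_on p {..n}"
    by (metis atMost_iff linorder_inj_onI')
  then have n_le: "n \<le> CARD('a)"
    using card_inj_on_le[OF inj, of UNIV] by simp
  \<comment> \<open>The edges of the path already differ in their first vertex.\<close>
  have inj_step: "inj_on (\<lambda>i. (p i, p (Suc i))) {..<n}"
    using inj by (auto simp: inj_on_def)
  have "(f a - f b)\<^sup>2 = (\<Sum>i<n. (f (p (Suc i)) - f (p i)))\<^sup>2"
    by (subst sum_lessThan_telescope) (simp add: p power2_commute)
  also have "\<dots> \<le> (\<Sum>i<n. (f (p (Suc i)) - f (p i))\<^sup>2) * real n"
    using sum_squared_le_sum_of_squares[of "\<lambda>i. f (p (Suc i)) - f (p i)" "{..<n}"] by simp
  also have "(\<Sum>i<n. (f (p (Suc i)) - f (p i))\<^sup>2)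
      = (\<Sum>(x, y)\<in>(\<lambda>i. (p i, p (Suc i))) ` {..<n}. (f x - f y)\<^sup>2)"
    by (subst sum.reindex[OF inj_step]) (simp add: power2_commute)
  also have "\<dots> \<le> (\<Sum>(x, y)\<in>R. (f x - f y)\<^sup>2)"
    using p(3) by (intro sum_mono2) auto
  finally have "(f a - f b)\<^sup>2 \<le> (\<Sum>(x, y)\<in>R. (f x - f y)\<^sup>2) * real n"
    by (simp add: mult_right_mono)
  also have "\<dots> \<le> (\<Sum>(x, y)\<in>R. (f x - f y)\<^sup>2) * real CARD('a)"
    using n_le by (intro mult_left_mono sum_nonneg) auto
  finally show ?thesis
    by (simp add: mult.commute)
qed

section \<open>Means, variances, and the smallest weight and rate\<close>

lemma span_one_iff: "(f :: real ^ 'n) \<in> span {1} \<longleftrightarrow> (\<exists>c. \<forall>z. f $ z = c)"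
  by (auto simp: span_singleton vec_eq_iff)

lemma mean_const: "\<zeta> \<in> pos_prob \<Longrightarrow> (\<And>z. f $ z = c) \<Longrightarrow> mean \<zeta> f = c"
  by (simp add: mean_def pos_prob_def flip: sum_distrib_left)

lemma mean_pos: "\<zeta> \<in> pos_prob \<Longrightarrow> (\<And>z. f $ z > 0) \<Longrightarrow> mean \<zeta> f > 0"
  unfolding mean_def pos_prob_def by (intro sum_pos) auto

lemma mean_affine:
  "\<zeta> \<in> pos_prob \<Longrightarrow> mean \<zeta> (\<chi> z. c * f $ z + d) = c * mean \<zeta> f + d"
  by (simp add: mean_def pos_prob_def algebra_simps sum.distrib flip: sum_distrib_left)

lemma var_eq_centred:
  assumes "\<zeta> \<in> pos_prob"
  shows "var \<zeta> f = (\<Sum>z\<in>UNIV. (f $ z - mean \<zeta> f)\<^sup>2 * \<zeta> $ z)"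
proof -
  let ?m = "mean \<zeta> f"
  have "(\<Sum>z\<in>UNIV. (f $ z - ?m)\<^sup>2 * \<zeta> $ z)
      = (\<Sum>z\<in>UNIV. (f $ z)\<^sup>2 * \<zeta> $ z - 2 * ?m * (f $ z * \<zeta> $ z) + ?m\<^sup>2 * \<zeta> $ z)"
    by (intro sum.cong) (auto simp: power2_eq_square algebra_simps)
  also have "\<dots> = (\<Sum>z\<in>UNIV. (f $ z)\<^sup>2 * \<zeta> $ z) - 2 * ?m * ?m + ?m\<^sup>2"
    using assms
    by (simp add: sum.distrib sum_subtractf mean_def pos_prob_def flip: sum_distrib_left)
  finally show ?thesis
    by (simp add: var_def mean_def power2_eq_square)
qed

text \<open>Brings in the pairwise differences that the path bound controls.\<close>

lemma var_eq_double_sum: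
  assumes "\<zeta> \<in> pos_prob"
  shows "var \<zeta> f = 1/2 * (\<Sum>z\<in>UNIV. \<Sum>z'\<in>UNIV. \<zeta> $ z * \<zeta> $ z' * (f $ z - f $ z')\<^sup>2)"
proof -
  have "(\<Sum>z\<in>UNIV. \<Sum>z'\<in>UNIV. \<zeta> $ z * \<zeta> $ z' * (f $ z - f $ z')\<^sup>2)
      = (\<Sum>z\<in>UNIV. \<Sum>z'\<in>UNIV. ((f $ z)\<^sup>2 * \<zeta> $ z) * \<zeta> $ z' + \<zeta> $ z * ((f $ z')\<^sup>2 * \<zeta> $ z')
           - 2 * ((f $ z * \<zeta> $ z) * (f $ z' * \<zeta> $ z')))"
    by (intro sum.cong) (auto simp: power2_eq_square algebra_simps)
  also have "\<dots> = 2 * ((\<Sum>z\<in>UNIV. (f $ z)\<^sup>2 * \<zeta> $ z) - (\<Sum>z\<in>UNIV. f $ z * \<zeta> $ z)\<^sup>2)"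
    using assms
    by (simp add: sum.distrib sum_subtractf pos_prob_def power2_eq_square
        flip: sum_distrib_left sum_distrib_right)
  finally show ?thesis
    by (simp add: var_def mean_def)
qed

lemma var_pos:
  assumes "\<zeta> \<in> pos_prob" "f \<notin> span {1}"
  shows "var \<zeta> f > 0"
proof -
  obtain z where "f $ z \<noteq> mean \<zeta> f"
    using assms(2) by (auto simp: span_one_iff)
  then show ?thesis
    using assms(1) unfolding var_eq_centred[OF assms(1)] pos_prob_def
    by (intro sum_pos2[of _ z]) (auto simp: less_imp_le)
qed

text \<open>Together with \<open>dirichlet_form_affine\<close>, this makes the Rayleigh quotient
  invariant under affine changes of \<open>f\<close> with \<open>c\<close> nonzero.\<close>

lemma var_affine:
  assumes "\<zeta> \<in> pos_prob"
  shows "var \<zeta> (\<chi> z. c * f $ z + d) = c\<^sup>2 * var \<zeta> f"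
  unfolding var_eq_centred[OF assms] mean_affine[OF assms] sum_distrib_left
  by (intro sum.cong) (auto simp: power2_eq_square algebra_simps)

lemma dirichlet_form_affine:
  "dirichlet_form \<zeta> (\<chi> z. c * f $ z + d) K = c\<^sup>2 * dirichlet_form \<zeta> f K"
  unfolding dirichlet_form_def sum_distrib_left
  by (intro sum.cong) (auto simp: power2_eq_square algebra_simps)

lemma min_weight_le: "min_weight \<zeta> \<le> \<zeta> $ z"
  unfolding min_weight_def
  by (rule Min_le) (auto simp: full_SetCompr_eq)

lemma min_weight_pos:
  assumes "\<zeta> \<in> pos_prob"
  shows "min_weight \<zeta> > 0"
proof -
  have "min_weight \<zeta> \<in> {\<zeta> $ z | z. z \<in> UNIV}"
    unfolding min_weight_def by (rule Min_in) (auto simp: full_SetCompr_eq)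
  then show ?thesis
    using assms by (auto simp: pos_prob_def)
qed

lemma finite_positive_rates: "finite {M $ z $ z' | z z'. M $ z $ z' > (0::real)}"
  by (rule finite_subset[of _ "range (\<lambda>(z, z'). M $ z $ z')"]) auto

lemma min_rate_le: "M $ z $ z' > 0 \<Longrightarrow> min_rate M \<le> M $ z $ z'"
  unfolding min_rate_def by (intro Min_le finite_positive_rates) auto

lemma obtain_distinct:
  assumes "CARD('n) \<ge> 2"
  obtains a b :: "'n::finite" where "a \<noteq> b"
  using assms card_le_Suc0_iff_eq[of "UNIV :: 'n set"] by force

lemma min_rate_pos:
  fixes M :: "real ^ 'z ^ 'z::finite"
  assumes "CARD('z) \<ge> 2" "irreducible_chain M"
  shows "min_rate M > 0"
proof -
  obtain a b :: 'z where "a \<noteq> b"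
    using obtain_distinct[OF assms(1)] by blast
  \<comment> \<open>The path from \<open>a\<close> to \<open>b\<close> is not empty; its first jump
    shows that the set under \<open>Min\<close> is nonempty.\<close>
  then obtain c where "M $ a $ c > 0"
    using assms(2) unfolding irreducible_chain_def by (blast elim: converse_rtranclE)
  then have "min_rate M \<in> {M $ z $ z' | z z'. M $ z $ z' > 0}"
    unfolding min_rate_def
    by (intro Min_in finite_positive_rates) auto
  then show ?thesis
    by auto
qed

text \<open>Supplies the nonemptiness of the index sets of the infima.\<close>

lemma ex_positive_nonconstant:
  assumes "CARD('n) \<ge> 2"
  obtains f :: "real ^ 'n::finite" where "\<And>z. f $ z > 0" "f \<notin> span {1}"
proof -
  obtain a b :: 'n where "a \<noteq> b"
    using obtain_distinct[OF assms] by blast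
  define f :: "real ^ 'n" where "f = (\<chi> z. if z = a then 1 else 2)"
  have "f $ a \<noteq> f $ b"
    using \<open>a \<noteq> b\<close> by (simp add: f_def)
  then have "f \<notin> span {1}"
    unfolding span_one_iff by metis
  moreover have "f $ z > 0" for z
    by (simp add: f_def)
  ultimately show ?thesis
    using that by blast
qed

section \<open>Dirichlet form and Poincare inequality\<close>

text \<open>Only a diagonal rate can be negative, and there the squared difference vanishes.\<close>

lemma generator_term_nonneg:
  assumes "generator K" "\<zeta> \<in> pos_prob"
  shows "K $ z $ z' * \<zeta> $ z * (f $ z - f $ z')\<^sup>2 \<ge> 0"
  using assms by (cases "z = z'") (auto simp: generator_def pos_prob_def less_imp_le)

lemma dirichlet_form_nonneg:
  assumes "generator K" "\<zeta> \<in> pos_prob"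
  shows "dirichlet_form \<zeta> f K \<ge> 0"
  unfolding dirichlet_form_def using generator_term_nonneg[OF assms]
  by (auto intro!: sum_nonneg)

text \<open>Every genuine jump carries at least the product of the two minima as its weight, and the
  other pairs contribute nonnegative terms. The factor 2 undoes the half in
  \<open>dirichlet_form\<close>.\<close>

lemma edge_energy_le:
  fixes M :: "real ^ 'z ^ 'z::finite"
  assumes "generator M" "\<zeta> \<in> pos_prob"
  shows "min_weight \<zeta> * min_rate M * (\<Sum>(x, y)\<in>{(x, y). M $ x $ y > 0}. (f $ x - f $ y)\<^sup>2)
    \<le> 2 * dirichlet_form \<zeta> f M"
proof -
  let ?R = "{(x, y). M $ x $ y > 0}"
  have "min_weight \<zeta> * min_rate M * (\<Sum>(x, y)\<in>?R. (f $ x - f $ y)\<^sup>2)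
      = (\<Sum>(x, y)\<in>?R. min_rate M * min_weight \<zeta> * (f $ x - f $ y)\<^sup>2)"
    by (simp add: sum_distrib_left case_prod_unfold mult_ac)
  also have "\<dots> \<le> (\<Sum>(x, y)\<in>?R. M $ x $ y * \<zeta> $ x * (f $ x - f $ y)\<^sup>2)"
    using min_rate_le[of M] min_weight_le[of \<zeta>] min_weight_pos[OF assms(2)]
    by (intro sum_mono) (auto intro!: mult_right_mono mult_mono)
  also have "\<dots> \<le> (\<Sum>(x, y)\<in>UNIV. M $ x $ y * \<zeta> $ x * (f $ x - f $ y)\<^sup>2)"
    using generator_term_nonneg[OF assms] by (intro sum_mono2) auto
  also have "\<dots> = 2 * dirichlet_form \<zeta> f M"
    by (simp add: dirichlet_form_def sum.cartesian_product)
  finally show ?thesis .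
qed

text \<open>The path bound is the same for all pairs of states and the product weights sum to 1, so
  the variance is at most \<open>n * S / 2\<close>; this half matches the one left by
  \<open>edge_energy_le\<close>.\<close>

lemma poincare_inequality:
  fixes M :: "real ^ 'z ^ 'z::finite"
  assumes "CARD('z) \<ge> 2" "generator M" "irreducible_chain M" "\<zeta> \<in> pos_prob"
  shows "min_weight \<zeta> * min_rate M / real CARD('z) * var \<zeta> f \<le> dirichlet_form \<zeta> f M"
proof -
  define n where "n = real CARD('z)"
  define S where "S = (\<Sum>(x, y)\<in>{(x, y). M $ x $ y > 0}. (f $ x - f $ y)\<^sup>2)"
  have "var \<zeta> f \<le> 1/2 * (\<Sum>z\<in>UNIV. \<Sum>z'\<in>UNIV. \<zeta> $ z * \<zeta> $ z' * (n * S))"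
    unfolding var_eq_double_sum[OF assms(4)] n_def S_def
    using assms square_diff_le_path_energy[of _ _ "{(x, y). M $ x $ y > 0}" "\<lambda>z. f $ z"]
    by (intro mult_left_mono sum_mono) (auto simp: irreducible_chain_def pos_prob_def less_imp_le)
  also have "\<dots> = n * S / 2"
    using assms(4) by (simp add: pos_prob_def flip: sum_distrib_left sum_distrib_right)
  finally have "min_weight \<zeta> * min_rate M / n * var \<zeta> f
      \<le> min_weight \<zeta> * min_rate M / n * (n * S / 2)"
    using min_weight_pos[OF assms(4)] min_rate_pos[OF assms(1,3)]
    by (intro mult_left_mono) (auto simp: n_def)
  also have "\<dots> = min_weight \<zeta> * min_rate M * S / 2"
    by (simp add: n_def)
  also have "\<dots> \<le> dirichlet_form \<zeta> f M"
    using edge_energy_le[OF assms(2,4), of f] by (simp add: S_def)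
  finally show ?thesis
    by (simp add: n_def)
qed

section \<open>Fisher information against the energy of the square root\<close>

text \<open>With \<open>s = sqrt y / sqrt x\<close> the logarithm is \<open>2 * ln s\<close>, at
  most \<open>2 * (s - 1)\<close>, and \<open>s^2 - 1 - 2 * (s - 1)\<close> is the square of
  \<open>s - 1\<close>.\<close>

lemma sqrt_diff_square_le:
  fixes x y :: real
  assumes "x > 0" "y > 0"
  shows "(sqrt x - sqrt y)\<^sup>2 \<le> x * (y / x - 1 - ln (y / x))"
proof -
  have "ln (y / x) = 2 * ln (sqrt y / sqrt x)"
    using assms by (simp add: ln_div ln_sqrt)
  also have "\<dots> \<le> 2 * (sqrt y / sqrt x - 1)"
    using assms by (intro mult_left_mono ln_le_minus_one) auto
  finally have "x * (y / x - 1 - ln (y / x)) \<ge> x * (y / x - 1 - 2 * (sqrt y / sqrt x - 1))"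
    using assms by (intro mult_left_mono) auto
  also have "x * (y / x - 1 - 2 * (sqrt y / sqrt x - 1)) = y + x - 2 * (x / sqrt x * sqrt y)"
    using assms by (simp add: field_simps)
  also have "x / sqrt x = sqrt x"
    using assms by (simp add: real_div_sqrt)
  also have "y + x - 2 * (sqrt x * sqrt y) = (sqrt x - sqrt y)\<^sup>2"
    using assms by (simp add: power2_diff)
  finally show ?thesis .
qed

text \<open>Off the diagonal, \<open>sqrt_diff_square_le\<close> is multiplied by a nonnegative
  rate; on the diagonal, where the rate may be negative, both terms are 0.\<close>

lemma dirichlet_form_sqrt_le_fisher_info:
  assumes "generator K" "\<zeta> \<in> pos_prob" "\<And>z. \<phi> $ z > 0"
  shows "2 * dirichlet_form \<zeta> (\<chi> z. sqrt (\<phi> $ z)) K \<le> fisher_info \<zeta> \<phi> K"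
proof -
  have "K $ z $ z' * \<zeta> $ z * (sqrt (\<phi> $ z) - sqrt (\<phi> $ z'))\<^sup>2
      \<le> K $ z $ z' * \<zeta> $ z * \<phi> $ z * (\<phi> $ z' / \<phi> $ z - 1 - ln (\<phi> $ z' / \<phi> $ z))" for z z'
  proof (cases "z = z'")
    case True
    then show ?thesis
      using assms(3)[of z] by simp
  next
    case False
    then have "0 \<le> K $ z $ z' * \<zeta> $ z"
      using assms by (auto simp: generator_def pos_prob_def less_imp_le)
    then show ?thesis
      using mult_left_mono[OF sqrt_diff_square_le[OF assms(3)[of z] assms(3)[of z']], of "K $ z $ z' * \<zeta> $ z"]
      by (simp add: mult.assoc)
  qed
  then show ?thesis
    by (auto simp: dirichlet_form_def fisher_info_def intro!: sum_mono)
qed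

section \<open>Positivity of the entropy and its bound by the variance\<close>

text \<open>The strictly convex function \<open>x * ln x\<close> lies above its tangent at the mean
  \<open>m\<close>, strictly so for \<open>x\<close> other than \<open>m\<close>, and the tangent
  line averages to \<open>m * ln m\<close>.\<close>

lemma Ent_pos:
  assumes "\<zeta> \<in> pos_prob" "\<And>z. f $ z > 0" "f \<notin> span {1}"
  shows "Ent \<zeta> f > 0"
proof -
  define m where "m = mean \<zeta> f"
  have m: "m > 0"
    unfolding m_def by (intro mean_pos assms)
  have tangent: "x * ln x - x * ln m - x + m \<ge> 0 \<and> (x \<noteq> m \<longrightarrow> x * ln x - x * ln m - x + m > 0)"
    if "x > 0" for x
  proof -
    \<comment> \<open>Dividing by \<open>x\<close> turns the tangent inequality into
      \<open>ln u \<le> u - 1\<close> at \<open>u = m / x\<close>.\<close>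
    have eq: "x * ln x - x * ln m - x + m = x * (m / x - 1 - ln (m / x))"
      using that m by (simp add: field_simps ln_div)
    have "ln (m / x) \<le> m / x - 1" "ln (m / x) = m / x - 1 \<Longrightarrow> m / x = 1"
      using that m ln_le_minus_one[of "m / x"] ln_eq_minus_one[of "m / x"] by auto
    then show ?thesis
      unfolding eq using that by (auto simp: less_le)
  qed
  obtain z where z: "f $ z \<noteq> m"
    using assms(3) by (auto simp: span_one_iff)
  have "0 < (\<Sum>z\<in>UNIV. (f $ z * ln (f $ z) - f $ z * ln m - f $ z + m) * \<zeta> $ z)"
    using tangent assms(1,2) z
    by (intro sum_pos2[of _ z]) (auto simp: pos_prob_def less_imp_le)
  also have "\<dots> = (\<Sum>z\<in>UNIV. f $ z * ln (f $ z) * \<zeta> $ z - ln m * (f $ z * \<zeta> $ z)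
      - f $ z * \<zeta> $ z + m * \<zeta> $ z)"
    by (simp add: algebra_simps)
  also have "\<dots> = (\<Sum>z\<in>UNIV. f $ z * ln (f $ z) * \<zeta> $ z) - ln m * m - m + m * 1"
    using assms(1)
    by (simp add: sum.distrib sum_subtractf m_def mean_def pos_prob_def flip: sum_distrib_left)
  finally show ?thesis
    by (simp add: Ent_def m_def mult.commute)
qed

text \<open>The segment from the constant \<open>m\<close> ends in \<open>f\<close> at
  \<open>t = 1\<close>, and half of the bound on the second derivative is the stated
  constant.\<close>

lemma Ent_square_le:
  assumes "\<zeta> \<in> pos_prob" "\<And>z. f $ z > 0"
  shows "Ent \<zeta> (\<chi> z. (f $ z)\<^sup>2) \<le> (2 + ln (1 / min_weight \<zeta>)) * var \<zeta> f"
proof -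
  define m where "m = mean \<zeta> f"
  define g where "g = (\<lambda>z. f $ z - m)"
  define v where "v = (\<Sum>z\<in>UNIV. (g z)\<^sup>2 * \<zeta> $ z)"
  define L where "L = ln (1 / min_weight \<zeta>)"
  define x where "x = (\<lambda>t z. m + t * g z)"
  \<comment> \<open>The mean of the square of \<open>x t\<close>; its cross term vanishes because
    \<open>g\<close> has mean 0.\<close>
  define S where "S = (\<lambda>t. m\<^sup>2 + t\<^sup>2 * v)"
  \<comment> \<open>For positive \<open>x t z\<close>, the factor \<open>2 * ln (x t z)\<close> is
    the logarithm of the square.\<close>
  define F where "F = (\<lambda>t. (\<Sum>z\<in>UNIV. (x t z)\<^sup>2 * (2 * ln (x t z)) * \<zeta> $ z) - S t * ln (S t))"
  define F' where "F' = (\<lambda>t. (\<Sum>z\<in>UNIV. (4 * x t z * ln (x t z) + 2 * x t z) * g z * \<zeta> $ z)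
    - (2 * t * v * ln (S t) + 2 * t * v))"
  define F'' where "F'' = (\<lambda>t. (\<Sum>z\<in>UNIV. (4 * ln (x t z) + 6) * (g z)\<^sup>2 * \<zeta> $ z)
    - (2 * v * ln (S t) + (2 * t * v)\<^sup>2 / S t + 2 * v))"
  have \<zeta>: "\<zeta> $ z > 0" "(\<Sum>z\<in>UNIV. \<zeta> $ z) = 1" for z
    using assms(1) by (auto simp: pos_prob_def)
  have m: "m > 0"
    unfolding m_def by (intro mean_pos assms)
  have v: "v \<ge> 0" "v = var \<zeta> f"
    unfolding v_def g_def m_def using \<zeta>(1) var_eq_centred[OF assms(1)]
    by (auto intro!: sum_nonneg simp: less_imp_le)
  have g: "(\<Sum>z\<in>UNIV. g z * \<zeta> $ z) = 0"
    using \<zeta>(2) by (simp add: g_def m_def mean_def left_diff_distrib sum_subtractf flip: sum_distrib_left)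
  have S: "S t > 0" for t
    using m v(1) by (simp add: S_def add_pos_nonneg)
  have x: "x t z > 0" if "0 \<le> t" "t \<le> 1" for t z
  proof -
    \<comment> \<open>On \<open>[0, 1]\<close> this is a convex combination of two positive numbers,
      so the logarithms are differentiable there.\<close>
    have "x t z = (1 - t) * m + t * f $ z"
      by (simp add: x_def g_def algebra_simps)
    moreover have "\<dots> > 0"
      using m assms(2)[of z] that by (cases "t = 0") (auto intro: add_nonneg_pos)
    ultimately show ?thesis
      by simp
  qed
  have S_eq: "S t = (\<Sum>z\<in>UNIV. (x t z)\<^sup>2 * \<zeta> $ z)" for t
  proof -
    have "(\<Sum>z\<in>UNIV. (x t z)\<^sup>2 * \<zeta> $ z)
        = (\<Sum>z\<in>UNIV. m\<^sup>2 * \<zeta> $ z + 2 * m * t * (g z * \<zeta> $ z) + t\<^sup>2 * ((g z)\<^sup>2 * \<zeta> $ z))"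
      by (simp add: x_def power2_eq_square algebra_simps)
    also have "\<dots> = S t"
      using \<zeta>(2) g by (simp add: sum.distrib S_def v_def flip: sum_distrib_left)
    finally show ?thesis ..
  qed
  have dx: "((\<lambda>t. x t z) has_real_derivative g z) (at t)" for t z
    unfolding x_def by (auto intro!: derivative_eq_intros)
  have dS: "(S has_real_derivative 2 * t * v) (at t)" for t
    unfolding S_def by (auto intro!: derivative_eq_intros)
  have F: "(F has_real_derivative F' t) (at t)" if "0 \<le> t" "t \<le> 1" for t
  proof -
    have "((\<lambda>t. (x t z)\<^sup>2 * (2 * ln (x t z)) * \<zeta> $ z) has_real_derivative
        (4 * x t z * ln (x t z) + 2 * x t z) * g z * \<zeta> $ z) (at t)" for z
      using x[OF that, of z]
      by (auto intro!: derivative_eq_intros dx simp: field_simps power2_eq_square)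
    moreover have "((\<lambda>t. S t * ln (S t)) has_real_derivative
        2 * t * v * ln (S t) + 2 * t * v) (at t)"
      using S[of t] by (auto intro!: derivative_eq_intros dS)
    ultimately show ?thesis
      unfolding F_def F'_def by (intro DERIV_diff DERIV_sum)
  qed
  have F': "(F' has_real_derivative F'' t) (at t)" if "0 \<le> t" "t \<le> 1" for t
    unfolding F'_def F''_def using x[OF that] S[of t] x[OF that, THEN less_imp_neq, symmetric]
    by (auto intro!: derivative_eq_intros dx dS sum.cong simp: field_simps power2_eq_square)
  have F'': "F'' t \<le> 2 * (2 + L) * v" if "0 \<le> t" "t \<le> 1" for t
  proof -
    have ln_le: "2 * ln (x t z) \<le> ln (S t) + L" for z
    proof -
      \<comment> \<open>A single term of a mean of squares is at most the whole mean; this is the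
        origin of \<open>L\<close>.\<close>
      have "min_weight \<zeta> * (x t z)\<^sup>2 \<le> (x t z)\<^sup>2 * \<zeta> $ z"
        using min_weight_le[of \<zeta> z] by (simp add: mult.commute mult_right_mono)
      also have "\<dots> \<le> S t"
        unfolding S_eq using \<zeta>(1) by (intro member_le_sum) (auto simp: less_imp_le)
      finally have "(x t z)\<^sup>2 \<le> S t / min_weight \<zeta>"
        using min_weight_pos[OF assms(1)] by (simp add: field_simps)
      then have "ln ((x t z)\<^sup>2) \<le> ln (S t / min_weight \<zeta>)"
        using x[OF that, of z] by (intro ln_mono) auto
      then show ?thesis
        using x[OF that, of z] S[of t] min_weight_pos[OF assms(1)]
        by (simp add: L_def ln_div ln_realpow)
    qed
    have "4 * ln (x t z) \<le> 2 * (ln (S t) + L)" for z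
      using ln_le[of z] by simp
    then have "(\<Sum>z\<in>UNIV. (4 * ln (x t z) + 6) * (g z)\<^sup>2 * \<zeta> $ z)
        \<le> (\<Sum>z\<in>UNIV. (2 * (ln (S t) + L) + 6) * (g z)\<^sup>2 * \<zeta> $ z)"
      using \<zeta>(1) by (intro sum_mono mult_right_mono) (auto simp: less_imp_le)
    also have "\<dots> = (2 * (ln (S t) + L) + 6) * v"
      by (simp add: v_def sum_distrib_left mult.assoc)
    moreover have "(2 * t * v)\<^sup>2 / S t \<ge> 0"
      using S[of t] by simp
    ultimately show ?thesis
      by (simp add: F''_def algebra_simps)
  qed
  \<comment> \<open>Monotonicity used twice replaces a Taylor remainder: \<open>G'\<close> is
    nondecreasing from 0, hence nonnegative, hence \<open>G 0 \<le> G 1\<close>.\<close>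
  define G where "G = (\<lambda>t. (2 + L) * v * t\<^sup>2 - F t)"
  define G' where "G' = (\<lambda>t. 2 * (2 + L) * v * t - F' t)"
  \<comment> \<open>At 0 every \<open>x 0 z\<close> equals \<open>m\<close>, so the logarithm leaves
    the sum and only the mean of \<open>g\<close> remains.\<close>
  have "F' 0 = (4 * m * ln m + 2 * m) * (\<Sum>z\<in>UNIV. g z * \<zeta> $ z)"
    by (simp add: F'_def x_def sum_distrib_left mult.assoc)
  then have "G' 0 = 0"
    using g by (simp add: G'_def)
  have dG': "(G' has_real_derivative 2 * (2 + L) * v - F'' t) (at t)" if "0 \<le> t" "t \<le> 1" for t
    unfolding G'_def by (intro DERIV_diff F' that) (auto intro!: derivative_eq_intros)
  have "G' t \<ge> G' 0" if "0 \<le> t" "t \<le> 1" for t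
  proof (rule DERIV_nonneg_imp_nondecreasing[of _ _ G'])
    fix s assume "0 \<le> s" "s \<le> t"
    then show "\<exists>y. (G' has_real_derivative y) (at s) \<and> 0 \<le> y"
      using that dG'[of s] F''[of s] by (intro exI[of _ "2 * (2 + L) * v - F'' s"]) auto
  qed (rule that)
  then have "G' t \<ge> 0" if "0 \<le> t" "t \<le> 1" for t
    using that \<open>G' 0 = 0\<close> by simp
  moreover have "(G has_real_derivative G' t) (at t)" if "0 \<le> t" "t \<le> 1" for t
    unfolding G_def G'_def by (intro DERIV_diff F that) (auto intro!: derivative_eq_intros)
  ultimately have "G 0 \<le> G 1"
    by (intro DERIV_nonneg_imp_nondecreasing[of 0 1 G]) auto
  moreover have "F 0 = 0"
    using m \<zeta>(2) by (simp add: F_def x_def S_def ln_realpow flip: sum_distrib_left)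
  moreover have "F 1 = Ent \<zeta> (\<chi> z. (f $ z)\<^sup>2)"
    using assms(2) unfolding Ent_def mean_def F_def S_eq
    by (simp add: x_def g_def ln_realpow)
  ultimately show ?thesis
    by (simp add: G_def L_def v(2))
qed

text \<open>No weight exceeds 1. This keeps the denominators of the theorem positive.\<close>

lemma ln_inverse_min_weight_nonneg:
  assumes "\<zeta> \<in> pos_prob"
  shows "ln (1 / min_weight \<zeta>) \<ge> 0"
proof -
  have "\<zeta> $ z \<le> (\<Sum>z\<in>UNIV. \<zeta> $ z)" for z
    using assms by (intro member_le_sum) (auto simp: pos_prob_def less_imp_le)
  then have "min_weight \<zeta> \<le> 1"
    using assms min_weight_le[of \<zeta>] order_trans by (fastforce simp: pos_prob_def)
  then show ?thesis
    using min_weight_pos[OF assms] by simp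
qed

section \<open>The weighted inner product\<close>

definition weighted_inner :: "real ^ 'z::finite \<Rightarrow> real ^ 'z \<Rightarrow> real ^ 'z \<Rightarrow> real" where
  "weighted_inner \<zeta> f g = (\<Sum>z\<in>UNIV. f $ z * g $ z * \<zeta> $ z)"

lemma weighted_inner_commute: "weighted_inner \<zeta> f g = weighted_inner \<zeta> g f"
  by (simp add: weighted_inner_def mult.commute)

lemma weighted_inner_add_left:
  "weighted_inner \<zeta> (f + g) h = weighted_inner \<zeta> f h + weighted_inner \<zeta> g h"
  by (simp add: weighted_inner_def algebra_simps sum.distrib)

lemma weighted_inner_scaleR_left:
  "weighted_inner \<zeta> (c *\<^sub>R f) h = c * weighted_inner \<zeta> f h"
  by (simp add: weighted_inner_def sum_distrib_left mult.assoc)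

lemma weighted_inner_add_right:
  "weighted_inner \<zeta> h (f + g) = weighted_inner \<zeta> h f + weighted_inner \<zeta> h g"
  by (metis weighted_inner_commute weighted_inner_add_left)

lemma weighted_inner_scaleR_right:
  "weighted_inner \<zeta> h (c *\<^sub>R f) = c * weighted_inner \<zeta> h f"
  by (metis weighted_inner_commute weighted_inner_scaleR_left)

lemmas weighted_inner_simps =
  weighted_inner_add_left weighted_inner_scaleR_left
  weighted_inner_add_right weighted_inner_scaleR_right

lemma weighted_inner_self_eq_0:
  assumes "\<zeta> \<in> pos_prob" "weighted_inner \<zeta> f f = 0"
  shows "f = 0"
proof -
  have "(\<Sum>z\<in>UNIV. (f $ z)\<^sup>2 * \<zeta> $ z) = 0"
    using assms(2) by (simp add: weighted_inner_def power2_eq_square)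
  then have "\<forall>z\<in>UNIV. (f $ z)\<^sup>2 * \<zeta> $ z = 0"
    using assms(1) by (subst (asm) sum_nonneg_eq_0_iff) (auto simp: pos_prob_def less_imp_le)
  then show ?thesis
    using assms(1) by (auto simp: vec_eq_iff pos_prob_def) (metis less_irrefl)
qed

lemma mean_eq_weighted_inner: "mean \<zeta> f = weighted_inner \<zeta> f 1"
  by (simp add: mean_def weighted_inner_def)

lemma var_eq_weighted_inner: "var \<zeta> f = weighted_inner \<zeta> f f - (mean \<zeta> f)\<^sup>2"
  by (simp add: var_def mean_def weighted_inner_def power2_eq_square)

section \<open>The symmetrised generator and its quadratic form\<close>

lemma sym_generator_offdiag:
  "z' \<noteq> z \<Longrightarrow> sym_generator M \<zeta> $ z $ z' = sym_rate M \<zeta> z z'"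
  by (simp add: sym_generator_def)

lemma sym_generator_row_sum: "(\<Sum>z'\<in>UNIV. sym_generator M \<zeta> $ z $ z') = 0"
proof -
  have "(\<Sum>z'\<in>UNIV. sym_generator M \<zeta> $ z $ z')
      = sym_generator M \<zeta> $ z $ z + (\<Sum>z'\<in>UNIV - {z}. sym_generator M \<zeta> $ z $ z')"
    by (rule sum.remove) auto
  also have "(\<Sum>z'\<in>UNIV - {z}. sym_generator M \<zeta> $ z $ z') = (\<Sum>z'\<in>UNIV - {z}. sym_rate M \<zeta> z z')"
    by (intro sum.cong) (auto simp: sym_generator_offdiag)
  finally show ?thesis
    by (simp add: sym_generator_def)
qed

lemma generator_sym_generator:
  assumes "generator M" "\<zeta> \<in> pos_prob"
  shows "generator (sym_generator M \<zeta>)"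
  using assms sym_generator_row_sum[of M \<zeta>]
  by (auto simp: generator_def sym_generator_offdiag sym_rate_def pos_prob_def less_imp_le)

text \<open>Multiplying \<open>sym_rate\<close> by \<open>\<zeta> $ z\<close> clears the quotient
  and leaves an expression symmetric in \<open>z\<close> and \<open>z'\<close>.\<close>

lemma sym_generator_detailed_balance:
  assumes "\<zeta> \<in> pos_prob"
  shows "\<zeta> $ z * sym_generator M \<zeta> $ z $ z' = \<zeta> $ z' * sym_generator M \<zeta> $ z' $ z"
proof (cases "z = z'")
  case False
  then show ?thesis
    using assms
    by (simp add: sym_generator_offdiag sym_rate_def pos_prob_def field_simps less_imp_neq[symmetric])
qed auto

text \<open>The squared difference is symmetric, so each summand is the average of the summands of
  \<open>M\<close> at \<open>(z, z')\<close> and \<open>(z', z)\<close>; swapping the sums shows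
  that both halves have the same total.\<close>

lemma dirichlet_form_sym_generator:
  assumes "\<zeta> \<in> pos_prob"
  shows "dirichlet_form \<zeta> f (sym_generator M \<zeta>) = dirichlet_form \<zeta> f M"
proof -
  let ?D = "\<lambda>z z'. M $ z $ z' * \<zeta> $ z * (f $ z - f $ z')\<^sup>2"
  have "sym_generator M \<zeta> $ z $ z' * \<zeta> $ z * (f $ z - f $ z')\<^sup>2 = 1/2 * (?D z z' + ?D z' z)" for z z'
  proof (cases "z = z'")
    case False
    then have "sym_generator M \<zeta> $ z $ z' * \<zeta> $ z = 1/2 * (M $ z $ z' * \<zeta> $ z + M $ z' $ z * \<zeta> $ z')"
      using assms by (simp add: sym_generator_offdiag sym_rate_def pos_prob_def field_simps less_imp_neq[symmetric])
    then show ?thesis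
      by (simp add: algebra_simps power2_commute[of "f $ z'"])
  qed auto
  then have "(\<Sum>z\<in>UNIV. \<Sum>z'\<in>UNIV. sym_generator M \<zeta> $ z $ z' * \<zeta> $ z * (f $ z - f $ z')\<^sup>2)
      = (\<Sum>z\<in>UNIV. \<Sum>z'\<in>UNIV. 1/2 * (?D z z' + ?D z' z))"
    by (intro sum.cong refl)
  also have "\<dots> = 1/2 * ((\<Sum>z\<in>UNIV. \<Sum>z'\<in>UNIV. ?D z z') + (\<Sum>z\<in>UNIV. \<Sum>z'\<in>UNIV. ?D z' z))"
    by (simp only: sum.distrib flip: sum_distrib_left)
  also have "(\<Sum>z\<in>UNIV. \<Sum>z'\<in>UNIV. ?D z' z) = (\<Sum>z\<in>UNIV. \<Sum>z'\<in>UNIV. ?D z z')"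
    by (rule sum.swap)
  finally show ?thesis
    by (simp add: dirichlet_form_def)
qed

lemma weighted_inner_matrix:
  "weighted_inner \<zeta> f (K *v g) = (\<Sum>z\<in>UNIV. \<Sum>z'\<in>UNIV. \<zeta> $ z * K $ z $ z' * (f $ z * g $ z'))"
  by (simp add: weighted_inner_def matrix_vector_mult_def sum_distrib_left sum_distrib_right mult_ac)

lemma weighted_inner_self_adjoint:
  assumes "\<And>z z'. \<zeta> $ z * K $ z $ z' = \<zeta> $ z' * K $ z' $ z"
  shows "weighted_inner \<zeta> f (K *v g) = weighted_inner \<zeta> (K *v f) g"
proof -
  have "weighted_inner \<zeta> f (K *v g) = (\<Sum>z\<in>UNIV. \<Sum>z'\<in>UNIV. \<zeta> $ z' * K $ z' $ z * (f $ z * g $ z'))"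
    unfolding weighted_inner_matrix using assms by simp
  also have "\<dots> = (\<Sum>z\<in>UNIV. \<Sum>z'\<in>UNIV. \<zeta> $ z * K $ z $ z' * (f $ z' * g $ z))"
    by (rule sum.swap)
  finally show ?thesis
    by (simp add: weighted_inner_commute[of \<zeta> _ g] weighted_inner_matrix mult_ac)
qed

text \<open>Summation by parts: after expanding the square, the vanishing row sums remove the first
  square, detailed balance reduces the second to the same case, and the cross term remains.\<close>

lemma dirichlet_form_eq_weighted_inner:
  assumes "\<And>z z'. \<zeta> $ z * K $ z $ z' = \<zeta> $ z' * K $ z' $ z" "\<And>z. (\<Sum>z'\<in>UNIV. K $ z $ z') = 0"
  shows "dirichlet_form \<zeta> f K = - weighted_inner \<zeta> f (K *v f)"
proof -
  have row: "(\<Sum>z\<in>UNIV. \<Sum>z'\<in>UNIV. \<zeta> $ z * K $ z $ z' * (f $ z)\<^sup>2) = 0"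
    using assms(2) by (simp flip: sum_distrib_left sum_distrib_right)
  have "(\<Sum>z\<in>UNIV. \<Sum>z'\<in>UNIV. \<zeta> $ z * K $ z $ z' * (f $ z')\<^sup>2)
      = (\<Sum>z\<in>UNIV. \<Sum>z'\<in>UNIV. \<zeta> $ z' * K $ z' $ z * (f $ z')\<^sup>2)"
    using assms(1) by simp
  also have "\<dots> = 0"
    by (subst sum.swap) (rule row)
  finally have col: "(\<Sum>z\<in>UNIV. \<Sum>z'\<in>UNIV. \<zeta> $ z * K $ z $ z' * (f $ z')\<^sup>2) = 0" .
  have "(\<Sum>z\<in>UNIV. \<Sum>z'\<in>UNIV. K $ z $ z' * \<zeta> $ z * (f $ z - f $ z')\<^sup>2)
      = (\<Sum>z\<in>UNIV. \<Sum>z'\<in>UNIV. \<zeta> $ z * K $ z $ z' * (f $ z)\<^sup>2 + \<zeta> $ z * K $ z $ z' * (f $ z')\<^sup>2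
          - 2 * (\<zeta> $ z * K $ z $ z' * (f $ z * f $ z')))"
    by (intro sum.cong) (auto simp: power2_eq_square algebra_simps)
  also have "\<dots> = - 2 * weighted_inner \<zeta> f (K *v f)"
    using row col by (simp add: sum.distrib sum_subtractf weighted_inner_matrix flip: sum_distrib_left)
  finally show ?thesis
    by (simp add: dirichlet_form_def)
qed

section \<open>Eigenvalues under detailed balance\<close>

lemma eigenvalue_of_uminus:
  "eigenvalue_of (- K) l \<longleftrightarrow> (\<exists>f. f \<noteq> 0 \<and> K *v f = (- l) *\<^sub>R f)"
proof -
  have "(- K) *v f = l *\<^sub>R f \<longleftrightarrow> K *v f = (- l) *\<^sub>R f" for f
    by (auto simp: vec_eq_iff matrix_vector_mult_def sum_negf minus_equation_iff)
  then show ?thesis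
    by (simp add: eigenvalue_of_def)
qed

text \<open>The \<open>Min\<close> in \<open>spectral_gap\<close> needs a finite set. Eigenvectors
  for distinct eigenvalues are orthogonal, hence independent, so the dimension bounds their
  number.\<close>

lemma finite_eigenvalues_self_adjoint:
  fixes K :: "real ^ 'z ^ 'z::finite"
  assumes "\<zeta> \<in> pos_prob" "\<And>z z'. \<zeta> $ z * K $ z $ z' = \<zeta> $ z' * K $ z' $ z"
  shows "finite {l. eigenvalue_of K l}"
proof -
  let ?E = "{l. eigenvalue_of K l}"
  have "\<forall>l\<in>?E. \<exists>f. f \<noteq> 0 \<and> K *v f = l *\<^sub>R f"
    by (simp add: eigenvalue_of_def)
  then obtain e where e: "\<And>l. l \<in> ?E \<Longrightarrow> e l \<noteq> 0 \<and> K *v e l = l *\<^sub>R e l"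
    by metis
  \<comment> \<open>Scaling by the root of the weight turns the weighted inner product into the
    Euclidean one.\<close>
  define h :: "real \<Rightarrow> real ^ 'z" where "h = (\<lambda>l. \<chi> z. sqrt (\<zeta> $ z) * e l $ z)"
  have h_inner: "h l \<bullet> h k = weighted_inner \<zeta> (e l) (e k)" for l k
    unfolding inner_vec_def weighted_inner_def
  proof (intro sum.cong refl)
    fix z
    have "sqrt (\<zeta> $ z) * sqrt (\<zeta> $ z) = \<zeta> $ z"
      using assms(1) by (simp add: pos_prob_def less_imp_le)
    then show "h l $ z \<bullet> h k $ z = e l $ z * e k $ z * \<zeta> $ z"
      by (simp add: h_def algebra_simps)
  qed
  have orth: "h l \<bullet> h k = 0" if "l \<in> ?E" "k \<in> ?E" "l \<noteq> k" for l k
  proof -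
    \<comment> \<open>The two sides are \<open>k\<close> times and \<open>l\<close> times the same
      inner product.\<close>
    have "weighted_inner \<zeta> (e l) (K *v e k) = weighted_inner \<zeta> (K *v e l) (e k)"
      by (rule weighted_inner_self_adjoint[OF assms(2)])
    then show ?thesis
      using e[OF that(1)] e[OF that(2)] that(3) by (simp add: h_inner weighted_inner_simps)
  qed
  have nz: "h l \<noteq> 0" if "l \<in> ?E" for l
    using weighted_inner_self_eq_0[OF assms(1), of "e l"] e[OF that] h_inner[of l l] by auto
  \<comment> \<open>Injectivity carries finiteness from the image of \<open>h\<close> back to the
    eigenvalues.\<close>
  have "inj_on h ?E"
    using orth nz by (metis inj_onI inner_eq_zero_iff)
  moreover have "independent (h ` ?E)"
    using orth nz by (intro pairwise_orthogonal_independent)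
      (auto simp: pairwise_def orthogonal_def)
  ultimately show ?thesis
    using independent_bound finite_imageD by blast
qed

section \<open>Rayleigh quotient and spectral gap\<close>

text \<open>By affine invariance every value of the quotient is taken on centred unit vectors. These
  form a compact set without constants, on which the quotient is continuous.\<close>

lemma rayleigh_minimiser:
  fixes K :: "real ^ 'z ^ 'z::finite"
  assumes "CARD('z) \<ge> 2" "\<zeta> \<in> pos_prob"
  obtains f where "f \<notin> span {1}" "mean \<zeta> f = 0"
    "\<And>g. g \<notin> span {1} \<Longrightarrow> dirichlet_form \<zeta> f K / var \<zeta> f \<le> dirichlet_form \<zeta> g K / var \<zeta> g"
proof -
  let ?r = "\<lambda>f. dirichlet_form \<zeta> f K / var \<zeta> f"
  define C where "C = sphere 0 1 \<inter> {f. mean \<zeta> f = 0}"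
  have cont_mean: "continuous_on A (mean \<zeta>)" for A
    unfolding mean_def by (intro continuous_intros)
  have "compact C"
    unfolding C_def using cont_mean[of UNIV]
    by (intro compact_Int_closed compact_sphere closed_Collect_eq) auto
  have nonconst: "f \<notin> span {1}" if "f \<in> C" for f
  proof
    assume "f \<in> span {1}"
    then obtain c where c: "\<And>z. f $ z = c"
      by (auto simp: span_one_iff)
    then have "f = 0"
      using that mean_const[OF assms(2) c] by (simp add: C_def vec_eq_iff)
    then show False
      using that by (simp add: C_def)
  qed
  have cont: "continuous_on C ?r"
  proof (rule continuous_on_divide)
    show "continuous_on C (\<lambda>f. dirichlet_form \<zeta> f K)"
      unfolding dirichlet_form_def by (intro continuous_intros)
    show "continuous_on C (var \<zeta>)"
      unfolding var_def mean_def by (simp, intro continuous_intros)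
    show "\<forall>f\<in>C. var \<zeta> f \<noteq> 0"
      using var_pos[OF assms(2) nonconst] by force
  qed
  have normalise: "\<exists>h\<in>C. ?r h = ?r g" if "g \<notin> span {1}" for g
  proof -
    define h0 where "h0 = (\<chi> z. 1 * g $ z + - mean \<zeta> g)"
    have "h0 \<noteq> 0"
      using that by (auto simp: h0_def vec_eq_iff span_one_iff)
    define N where "N = norm h0"
    have N: "N > 0"
      using \<open>h0 \<noteq> 0\<close> by (simp add: N_def)
    \<comment> \<open>The shape \<open>c * g $ z + d\<close> lets the three affine lemmas
      apply.\<close>
    define h where "h = (\<chi> z. 1 / N * g $ z + - mean \<zeta> g / N)"
    have "h = (1 / N) *\<^sub>R h0"
      by (simp add: h_def h0_def vec_eq_iff diff_divide_distrib)
    then have "norm h = 1"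
      using N by (simp add: N_def)
    moreover have "mean \<zeta> h = 0"
      unfolding h_def mean_affine[OF assms(2)] by simp
    ultimately have "h \<in> C"
      by (simp add: C_def)
    moreover have "?r h = ?r g"
      unfolding h_def var_affine[OF assms(2)] dirichlet_form_affine using N by simp
    ultimately show ?thesis
      by blast
  qed
  have "C \<noteq> {}"
    using normalise ex_positive_nonconstant[OF assms(1)] by blast
  then obtain f where "f \<in> C" "\<And>h. h \<in> C \<Longrightarrow> ?r f \<le> ?r h"
    using continuous_attains_inf[OF \<open>compact C\<close> _ cont] by blast
  then show ?thesis
    using that nonconst normalise by (metis (mono_tags, lifting) C_def IntE mem_Collect_eq)
qed

text \<open>The infimum is a minimum; division is cleared because the variance is positive off the
  constants.\<close>

lemma alpha_gPI_attained:
  fixes M :: "real ^ 'z ^ 'z::finite"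
  assumes "CARD('z) \<ge> 2" "\<zeta> \<in> pos_prob"
  obtains f where "f \<notin> span {1}" "mean \<zeta> f = 0"
    "dirichlet_form \<zeta> f M = alpha_gPI M \<zeta> * var \<zeta> f"
    "\<And>g. g \<notin> span {1} \<Longrightarrow> alpha_gPI M \<zeta> * var \<zeta> g \<le> dirichlet_form \<zeta> g M"
proof -
  obtain f where f: "f \<notin> span {1}" "mean \<zeta> f = 0"
    "\<And>g. g \<notin> span {1} \<Longrightarrow> dirichlet_form \<zeta> f M / var \<zeta> f \<le> dirichlet_form \<zeta> g M / var \<zeta> g"
    using rayleigh_minimiser[OF assms] by blast
  have eq: "alpha_gPI M \<zeta> = dirichlet_form \<zeta> f M / var \<zeta> f"
    unfolding alpha_gPI_def using f by (intro cInf_eq_minimum) auto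
  show ?thesis
  proof
    show "dirichlet_form \<zeta> f M = alpha_gPI M \<zeta> * var \<zeta> f"
      using var_pos[OF assms(2) f(1)] by (simp add: eq)
    show "alpha_gPI M \<zeta> * var \<zeta> g \<le> dirichlet_form \<zeta> g M" if "g \<notin> span {1}" for g
      using f(3)[OF that] var_pos[OF assms(2) that] by (simp add: eq pos_le_divide_eq)
  qed (use f in auto)
qed

lemma alpha_gPI_ge:
  fixes M :: "real ^ 'z ^ 'z::finite"
  assumes "CARD('z) \<ge> 2" "generator M" "irreducible_chain M" "\<zeta> \<in> pos_prob"
  shows "alpha_gPI M \<zeta> \<ge> min_weight \<zeta> * min_rate M / real CARD('z)"
proof -
  obtain f where f: "f \<notin> span {1}" "dirichlet_form \<zeta> f M = alpha_gPI M \<zeta> * var \<zeta> f"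
    using alpha_gPI_attained[OF assms(1,4)] by metis
  show ?thesis
    using poincare_inequality[OF assms, of f] var_pos[OF assms(4) f(1)]
    unfolding f(2) by (rule mult_right_le_imp_le)
qed

text \<open>A minimiser is an eigenvector, and every nonzero eigenvalue is the Rayleigh quotient of
  a centred vector, hence not smaller. The hypothesis that \<open>alpha_gPI M \<zeta>\<close> is
  nonzero places it in the set under \<open>Min\<close>.\<close>

lemma spectral_gap_eq_alpha_gPI:
  fixes M :: "real ^ 'z ^ 'z::finite"
  assumes "CARD('z) \<ge> 2" "generator M" "\<zeta> \<in> pos_prob" "alpha_gPI M \<zeta> \<noteq> 0"
  shows "spectral_gap (sym_generator M \<zeta>) = alpha_gPI M \<zeta>"
proof -
  define K where "K = sym_generator M \<zeta>"
  define a where "a = alpha_gPI M \<zeta>"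
  note balance = sym_generator_detailed_balance[OF assms(3), where M = M, folded K_def]
  note energy = dirichlet_form_eq_weighted_inner[OF balance sym_generator_row_sum[where M = M and \<zeta> = \<zeta>, folded K_def]]
  note adjoint = weighted_inner_self_adjoint[OF balance]
  note energy_M = dirichlet_form_sym_generator[OF assms(3), where M = M, folded K_def]
  obtain f where f: "f \<notin> span {1}" "mean \<zeta> f = 0" "dirichlet_form \<zeta> f K = a * var \<zeta> f"
    and least: "\<And>g. g \<notin> span {1} \<Longrightarrow> a * var \<zeta> g \<le> dirichlet_form \<zeta> g K"
    using alpha_gPI_attained[OF assms(1,3), of M] unfolding a_def energy_M by metis
  \<comment> \<open>A nonnegative quadratic form that vanishes at the minimiser
    \<open>f\<close>.\<close>
  define Q where "Q = (\<lambda>g. dirichlet_form \<zeta> g K - a * var \<zeta> g)"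
  have Q: "Q g \<ge> 0" for g
  proof (cases "g \<in> span {1}")
    case True
    then obtain c where "\<And>z. g $ z = c"
      by (auto simp: span_one_iff)
    then show ?thesis
      using mean_const[OF assms(3)] by (simp add: Q_def dirichlet_form_def var_def)
  next
    case False
    then show ?thesis
      using least by (simp add: Q_def)
  qed
  have "eigenvalue_of (- K) a"
  proof -
    \<comment> \<open>The defect in the eigenvalue equation. Perturbing \<open>f\<close> along
      \<open>h\<close> changes \<open>Q\<close> to first order by \<open>- 2 * t * s\<close>, with
      \<open>s\<close> the squared weighted norm of \<open>h\<close>.\<close>
    define h where "h = K *v f + a *\<^sub>R f"
    define s where "s = weighted_inner \<zeta> h h"
    have expand: "Q (f + t *\<^sub>R h) = - 2 * t * s + t\<^sup>2 * Q h" for t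
    proof -
      have "weighted_inner \<zeta> f (K *v h) = weighted_inner \<zeta> h (K *v f)"
        using adjoint weighted_inner_commute by metis
      moreover have "s = weighted_inner \<zeta> h (K *v f) + a * weighted_inner \<zeta> h f"
        unfolding s_def by (subst (2) h_def) (simp add: weighted_inner_simps)
      moreover have "Q f = 0"
        by (simp add: Q_def f(3))
      ultimately show ?thesis
        using f(2) weighted_inner_commute[of \<zeta> f h]
        unfolding Q_def energy var_eq_weighted_inner mean_eq_weighted_inner
        by (simp add: weighted_inner_simps algebra_simps power2_eq_square)
    qed
    have "s = 0"
    proof -
      define q where "q = Q h"
      have q: "q \<ge> 0"
        using Q by (simp add: q_def)
      \<comment> \<open>With this \<open>t\<close> the expansion equals
        \<open>- t\<^sup>2 * (q + 2)\<close>, which forces \<open>t = 0\<close>; the summand 1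
        covers \<open>q = 0\<close>.\<close>
      define t where "t = s / (q + 1)"
      have s: "s = t * (q + 1)"
        using q by (simp add: t_def)
      have "0 \<le> - 2 * t * s + t\<^sup>2 * q"
        using Q[of "f + t *\<^sub>R h"] by (simp add: expand q_def)
      then have "t\<^sup>2 * (q + 2) \<le> 0"
        by (simp add: s power2_eq_square algebra_simps)
      then have "t = 0"
        using q by (simp add: mult_le_0_iff)
      then show ?thesis
        by (simp add: s)
    qed
    then have "h = 0"
      using weighted_inner_self_eq_0[OF assms(3)] by (simp add: s_def)
    then have "K *v f = (- a) *\<^sub>R f"
      by (simp add: h_def eq_neg_iff_add_eq_0)
    moreover have "f \<noteq> 0"
      using f(1) span_zero by blast
    ultimately show ?thesis
      by (auto simp: eigenvalue_of_uminus)
  qed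
  moreover have "a \<le> l" if l: "eigenvalue_of (- K) l" "l \<noteq> 0" for l
  proof -
    obtain g where g: "g \<noteq> 0" "K *v g = (- l) *\<^sub>R g"
      using l(1) by (auto simp: eigenvalue_of_uminus)
    \<comment> \<open>Self-adjointness then makes eigenvectors for nonzero \<open>l\<close>
      orthogonal to constants, that is, centred.\<close>
    have "K *v 1 = 0"
      using sym_generator_row_sum[where M = M and \<zeta> = \<zeta>, folded K_def]
      by (simp add: vec_eq_iff matrix_vector_mult_def)
    then have "weighted_inner \<zeta> 1 (K *v g) = 0"
      unfolding adjoint by (simp add: weighted_inner_def)
    then have "mean \<zeta> g = 0"
      using l(2) g(2) by (simp add: mean_eq_weighted_inner weighted_inner_commute[of \<zeta> g]
          weighted_inner_scaleR_right[of \<zeta> _ "- l", simplified])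
    then have "var \<zeta> g = weighted_inner \<zeta> g g"
      by (simp add: var_eq_weighted_inner)
    moreover have "weighted_inner \<zeta> g g \<noteq> 0"
      using weighted_inner_self_eq_0[OF assms(3)] g(1) by blast
    moreover have "weighted_inner \<zeta> g g \<ge> 0"
      using assms(3) unfolding weighted_inner_def
      by (intro sum_nonneg) (simp add: pos_prob_def less_imp_le)
    moreover have "dirichlet_form \<zeta> g K = l * weighted_inner \<zeta> g g"
      unfolding energy g(2) weighted_inner_scaleR_right by simp
    ultimately show ?thesis
      using Q[of g] by (simp add: Q_def)
  qed
  moreover have "finite {l. eigenvalue_of (- K) l \<and> l \<noteq> 0}"
  proof (rule finite_subset)
    show "finite {l. eigenvalue_of (- K) l}"
      by (rule finite_eigenvalues_self_adjoint[OF assms(3)]) (simp add: balance)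
  qed auto
  ultimately have "spectral_gap K = a"
    unfolding spectral_gap_def using assms(4) by (intro Min_eqI) (auto simp: a_def)
  then show ?thesis
    by (simp add: K_def a_def)
qed

section \<open>Comparison of the log-Sobolev constants\<close>

text \<open>Squaring is injective on positive numbers, so the square is again nonconstant. Thus the
  denominators in \<open>alpha_sLSI\<close> are positive.\<close>

lemma Ent_square_pos:
  assumes "\<zeta> \<in> pos_prob" "\<And>z. f $ z > 0" "f \<notin> span {1}"
  shows "Ent \<zeta> (\<chi> z. (f $ z)\<^sup>2) > 0"
proof (rule Ent_pos[OF assms(1)])
  show "(\<chi> z. (f $ z)\<^sup>2) $ z > 0" for z
    using assms(2)[of z] by simp
  show "(\<chi> z. (f $ z)\<^sup>2) \<notin> span {1}"
  proof
    assume "(\<chi> z. (f $ z)\<^sup>2) \<in> span {1}"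
    then obtain c where "\<And>z. (f $ z)\<^sup>2 = c"
      by (auto simp: span_one_iff)
    then have "f $ z = sqrt c" for z
      using assms(2)[of z] real_sqrt_unique[of "f $ z" c] by (simp add: less_imp_le)
    then show False
      using assms(3) by (auto simp: span_one_iff)
  qed
qed

text \<open>The quotients are bounded below by 0, so the real infimum is a lower bound for each of
  them.\<close>

lemma alpha_sLSI_le:
  assumes "generator K" "\<zeta> \<in> pos_prob" "\<And>z. f $ z > 0" "f \<notin> span {1}"
  shows "alpha_sLSI K \<zeta> \<le> dirichlet_form \<zeta> f K / Ent \<zeta> (\<chi> z. (f $ z)\<^sup>2)"
  unfolding alpha_sLSI_def
proof (rule cINF_lower)
  have "0 \<le> dirichlet_form \<zeta> g K / Ent \<zeta> (\<chi> z. (g $ z)\<^sup>2)"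
    if "\<forall>z. g $ z > 0" "g \<notin> span {1}" for g
    using that by (intro divide_nonneg_pos dirichlet_form_nonneg assms Ent_square_pos) auto
  then show "bdd_below ((\<lambda>g. dirichlet_form \<zeta> g K / Ent \<zeta> (\<chi> z. (g $ z)\<^sup>2)) `
      {g. (\<forall>z. g $ z > 0) \<and> g \<notin> span {1}})"
    by (intro bdd_belowI2[of _ 0]) auto
qed (use assms in auto)

lemma density_nonconstant:
  assumes "\<zeta> \<in> pos_prob" "\<phi> \<in> densities \<zeta>" "\<phi> \<noteq> 1"
  shows "\<phi> \<notin> span {1}"
proof
  assume "\<phi> \<in> span {1}"
  then obtain c where c: "\<And>z. \<phi> $ z = c"
    by (auto simp: span_one_iff)
  then show False
    using assms mean_const[OF assms(1) c] by (simp add: densities_def vec_eq_iff)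
qed

text \<open>Each density \<open>\<phi>\<close> is tested through its square root \<open>f\<close>:
  the entropies agree, and the Fisher information is at least twice the energy of
  \<open>f\<close>.\<close>

lemma two_alpha_sLSI_le_alpha_gLSI:
  fixes M :: "real ^ 'z ^ 'z::finite"
  assumes "CARD('z) \<ge> 2" "generator M" "\<zeta> \<in> pos_prob"
  shows "2 * alpha_sLSI (sym_generator M \<zeta>) \<zeta> \<le> alpha_gLSI M \<zeta>"
  unfolding alpha_gLSI_def
proof (rule cINF_greatest)
  obtain f :: "real ^ 'z" where f: "\<And>z. f $ z > 0" "f \<notin> span {1}"
    using ex_positive_nonconstant[OF assms(1)] by blast
  \<comment> \<open>Dividing a nonconstant positive vector by its mean yields a density other than
    1, so the infimum is over a nonempty set.\<close>
  define \<phi> where "\<phi> = (\<chi> z. 1 / mean \<zeta> f * f $ z + 0)"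
  have m: "mean \<zeta> f > 0"
    by (intro mean_pos assms f)
  have "mean \<zeta> \<phi> = 1"
    unfolding \<phi>_def mean_affine[OF assms(3)] using m by simp
  moreover have "\<phi> $ z > 0" for z
    using f(1)[of z] m by (simp add: \<phi>_def)
  moreover have "\<phi> \<noteq> 1"
  proof -
    obtain z where "f $ z \<noteq> mean \<zeta> f"
      using f(2) by (auto simp: span_one_iff)
    then have "\<phi> $ z \<noteq> 1 $ z"
      using m by (simp add: \<phi>_def)
    then show ?thesis
      by auto
  qed
  ultimately show "{\<phi>. \<phi> \<in> densities \<zeta> \<and> \<phi> \<noteq> 1} \<noteq> {}"
    by (auto simp: densities_def)
next
  fix \<phi> assume "\<phi> \<in> {\<phi>. \<phi> \<in> densities \<zeta> \<and> \<phi> \<noteq> 1}"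
  then have \<phi>: "\<And>z. \<phi> $ z > 0" "mean \<zeta> \<phi> = 1" "\<phi> \<notin> span {1}"
    using density_nonconstant[OF assms(3), of \<phi>] by (simp_all add: densities_def)
  define f :: "real ^ 'z" where "f = (\<chi> z. sqrt (\<phi> $ z))"
  have f_sq: "(\<chi> z. (f $ z)\<^sup>2) = \<phi>"
    using \<phi>(1) by (simp add: f_def vec_eq_iff less_imp_le)
  have f_pos: "f $ z > 0" for z
    using \<phi>(1) by (simp add: f_def)
  have f_nonconst: "f \<notin> span {1}"
    using \<phi>(3) f_sq by (auto simp: span_one_iff vec_eq_iff) metis
  \<comment> \<open>The mean is 1, so the subtracted term in \<open>Ent\<close> contains
    \<open>ln 1 = 0\<close>.\<close>
  have Ent: "Ent \<zeta> \<phi> = rel_entropy \<zeta> \<phi>"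
    by (simp add: Ent_def rel_entropy_def \<phi>(2))
  have "2 * alpha_sLSI (sym_generator M \<zeta>) \<zeta> \<le> 2 * (dirichlet_form \<zeta> f M / rel_entropy \<zeta> \<phi>)"
    using alpha_sLSI_le[OF generator_sym_generator[OF assms(2,3)] assms(3) f_pos f_nonconst]
    by (simp add: f_sq Ent dirichlet_form_sym_generator[OF assms(3)])
  also have "\<dots> \<le> fisher_info \<zeta> \<phi> M / rel_entropy \<zeta> \<phi>"
    using dirichlet_form_sqrt_le_fisher_info[OF assms(2,3) \<phi>(1)] Ent_pos[OF assms(3) \<phi>(1,3)]
    by (simp add: f_def Ent divide_right_mono)
  finally show "2 * alpha_sLSI (sym_generator M \<zeta>) \<zeta> \<le> fisher_info \<zeta> \<phi> M / rel_entropy \<zeta> \<phi>" .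
qed

text \<open>Entropy of the square is bounded by variance through \<open>Ent_square_le\<close>, and
  variance by energy through \<open>alpha_gPI\<close>. The constant \<open>c\<close> is twice the
  denominator, whence the 2 on the right.\<close>

lemma alpha_gPI_le_two_alpha_sLSI:
  fixes M :: "real ^ 'z ^ 'z::finite"
  assumes "CARD('z) \<ge> 2" "generator M" "\<zeta> \<in> pos_prob"
  shows "alpha_gPI M \<zeta> / (1 + 1/2 * ln (1 / min_weight \<zeta>)) \<le> 2 * alpha_sLSI (sym_generator M \<zeta>) \<zeta>"
proof -
  define c where "c = 2 + ln (1 / min_weight \<zeta>)"
  have c: "c > 0"
    using ln_inverse_min_weight_nonneg[OF assms(3)] by (simp add: c_def)
  have "alpha_gPI M \<zeta> / c \<le> alpha_sLSI (sym_generator M \<zeta>) \<zeta>"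
    unfolding alpha_sLSI_def
  proof (rule cINF_greatest)
    show "{f :: real ^ 'z. (\<forall>z. f $ z > 0) \<and> f \<notin> span {1}} \<noteq> {}"
      using ex_positive_nonconstant[OF assms(1)] by blast
  next
    fix f :: "real ^ 'z" assume "f \<in> {f. (\<forall>z. f $ z > 0) \<and> f \<notin> span {1}}"
    then have f: "\<And>z. f $ z > 0" "f \<notin> span {1}"
      by auto
    define e where "e = Ent \<zeta> (\<chi> z. (f $ z)\<^sup>2)"
    have e: "e > 0"
      unfolding e_def by (intro Ent_square_pos assms f)
    obtain g where g: "g \<notin> span {1}" "dirichlet_form \<zeta> g M = alpha_gPI M \<zeta> * var \<zeta> g"
      and least: "\<And>g. g \<notin> span {1} \<Longrightarrow> alpha_gPI M \<zeta> * var \<zeta> g \<le> dirichlet_form \<zeta> g M"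
      using alpha_gPI_attained[OF assms(1,3)] by metis
    \<comment> \<open>The sign is needed to multiply the entropy bound by
      \<open>alpha_gPI M \<zeta>\<close>.\<close>
    have "alpha_gPI M \<zeta> \<ge> 0"
      using dirichlet_form_nonneg[OF assms(2,3), of g] var_pos[OF assms(3) g(1)]
      unfolding g(2) by (simp add: zero_le_mult_iff)
    then have "alpha_gPI M \<zeta> * e \<le> alpha_gPI M \<zeta> * (c * var \<zeta> f)"
      unfolding e_def c_def using Ent_square_le[OF assms(3) f(1)] by (rule mult_left_mono[rotated])
    also have "\<dots> \<le> c * dirichlet_form \<zeta> f M"
      using least[OF f(2)] c by simp
    finally show "alpha_gPI M \<zeta> / c
        \<le> dirichlet_form \<zeta> f (sym_generator M \<zeta>) / Ent \<zeta> (\<chi> z. (f $ z)\<^sup>2)"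
      using c e by (simp add: dirichlet_form_sym_generator[OF assms(3)] e_def field_simps)
  qed
  moreover have "alpha_gPI M \<zeta> / (1 + 1/2 * ln (1 / min_weight \<zeta>)) = 2 * (alpha_gPI M \<zeta> / c)"
    using c by (simp add: c_def field_simps)
  ultimately show ?thesis
    by simp
qed

theorem theorem4p7:
  fixes M :: "real ^ 'z ^ 'z::finite" and \<zeta> :: "real ^ 'z"
  assumes "CARD('z) \<ge> 2"
    and "generator M"
    and "irreducible_chain M"
    and "\<zeta> \<in> pos_prob"
  shows "alpha_gPI M \<zeta> \<ge> min_weight \<zeta> * min_rate M / real CARD('z)
    \<and> (alpha_gLSI M \<zeta> \<ge> 2 * alpha_sLSI (sym_generator M \<zeta>) \<zeta>
      \<and> 2 * alpha_sLSI (sym_generator M \<zeta>) \<zeta>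
          \<ge> spectral_gap (sym_generator M \<zeta>) / (1 + 1/2 * ln (1 / min_weight \<zeta>))
      \<and> spectral_gap (sym_generator M \<zeta>) / (1 + 1/2 * ln (1 / min_weight \<zeta>))
          = alpha_gPI M \<zeta> / (1 + 1/2 * ln (1 / min_weight \<zeta>))
      \<and> alpha_gPI M \<zeta> / (1 + 1/2 * ln (1 / min_weight \<zeta>))
          \<ge> (min_weight \<zeta> * min_rate M * inverse (real CARD('z)))
              / (1 + 1/2 * ln (1 / min_weight \<zeta>)))"
proof -
  note gPI = alpha_gPI_ge[OF assms]
  \<comment> \<open>Strict positivity of the lower bound in part (1) excludes the value 0, as the
    identification with the spectral gap requires.\<close>
  have "0 < min_weight \<zeta> * min_rate M / real CARD('z)"
    using min_weight_pos[OF assms(4)] min_rate_pos[OF assms(1,3)] by simp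
  then have "alpha_gPI M \<zeta> \<noteq> 0"
    using gPI by linarith
  then have gap: "spectral_gap (sym_generator M \<zeta>) = alpha_gPI M \<zeta>"
    by (rule spectral_gap_eq_alpha_gPI[OF assms(1,2,4)])
  have "1 + 1/2 * ln (1 / min_weight \<zeta>) > 0"
    using ln_inverse_min_weight_nonneg[OF assms(4)] by simp
  then have "min_weight \<zeta> * min_rate M / real CARD('z) / (1 + 1/2 * ln (1 / min_weight \<zeta>))
      \<le> alpha_gPI M \<zeta> / (1 + 1/2 * ln (1 / min_weight \<zeta>))"
    using gPI by (intro divide_right_mono) auto
  then show ?thesis
    unfolding gap using gPI two_alpha_sLSI_le_alpha_gLSI[OF assms(1,2,4)]
      alpha_gPI_le_two_alpha_sLSI[OF assms(1,2,4)]
    by (simp only: divide_inverse[of _ "real CARD('z)"] simp_thms)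
qed

end
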